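(* (Soundness) For every set $\Gamma$ of formulas and every formula $A$ of $\mathbb{LP}(\square)$: if $\Gamma\vdash A$, then $\Gamma\models A$.
   Context: Formulas are built from propositional variables $p_0,p_1,p_2,\dots$ with $\neg,\land,\lor,\to$ and a unary operator $\square$. $A\leftrightarrow B$ abbreviates $(A\to B)\land(B\to A)$, and $\top$ abbreviates a fixed classical tautology such as $p_0\lor\neg p_0$. The logic $\mathbb{LP}(\square)$ (the modal version of the propositional logic of the plausible $\mathbb{L}(\nabla)$) extends classical propositional logic. Its axioms are all instances of a complete axiomatization of classical propositional logic (with Modus Ponens), together with all instances of - C: $\square A\land\square B\to\square(A\land B)$, - H: $\square A\lor\square B\to\square(A\lor B)$, - T: $\square A\to A$, - N: $\square\top$. Its rules are Modus Ponens (MP): from $A\to B$ and $A$ infer $B$; and the rule on theorems RE: if $\vdash A\leftrightarrow B$, then $\vdash\square A\leftrightarrow\square B$. Here $\vdash A$ means that $A$ is a theorem, i.e. obtainable from the axioms by MP and RE. A deduction of $A$ from $\Gamma$ is a finite sequence of formulas ending in $A$, each of which is an element of $\Gamma$, or an axiom, or obtained from earlier members of the sequence by MP, or of the form $\square B\leftrightarrow\square C$ where $\vdash B\leftrightarrow C$ (an application of RE, whose premise must be a theorem, not merely a formula deduced from $\Gamma$). $\Gamma\vdash A$ means that such a deduction exists. A relational model is a triple $\mathcal{M}=\langle W,S,V\rangle$ where $W$ is a non-empty set (of possible worlds), $V$ assigns to each propositional variable a subset of $W$, and $S$ assigns to each $\alpha\in W$ a set $S(\alpha)\subseteq\mathcal{P}(W)$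 of subsets of $W$ such that for all $\alpha\in W$ and $X,Y\subseteq W$: - (c) if $X\in S(\alpha)$ and $Y\in S(\alpha)$, then $X\cap Y\in S(\alpha)$; - (h) if $X\in S(\alpha)$ or $Y\in S(\alpha)$, then $X\cup Y\in S(\alpha)$; - (t) if $X\in S(\alpha)$, then $\alpha\in X$; - (n) $W\in S(\alpha)$. Truth at a world, $\models^{\mathcal{M}}_{\alpha}A$: $\models^{\mathcal{M}}_{\alpha}p_i$ iff $\alpha\in V(p_i)$; the Boolean connectives are interpreted classically at each world; $\models^{\mathcal{M}}_{\alpha}\square A$ iff $\|A\|^{\mathcal{M}}\in S(\alpha)$, where $\|A\|^{\mathcal{M}}=\{\beta\in W:\ \models^{\mathcal{M}}_{\beta}A\}$. $\models^{\mathcal{M}}A$ means $\models^{\mathcal{M}}_{\alpha}A$ for all $\alpha\in W$, and $\models^{\mathcal{M}}\Gamma$ means $\models^{\mathcal{M}}A$ for every $A\in\Gamma$. $\Gamma\models A$ (global semantic consequence) means: for every relational model $\mathcal{M}$, if $\models^{\mathcal{M}}\Gamma$ then $\models^{\mathcal{M}}A$. *)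

theory Defs
  imports Main
begin

datatype fm =
    Var nat
  | Neg fm
  | And fm fm
  | Or fm fm
  | Imp fm fm
  | Box fm

definition Iff :: "fm \<Rightarrow> fm \<Rightarrow> fm" where
  "Iff A B = And (Imp A B) (Imp B A)"

definition Top :: fm where
  "Top = Or (Var 0) (Neg (Var 0))"

text \<open>Kleene's axiom schemata, which with Modus Ponens are complete for classical
  propositional logic.\<close>

inductive classical_axiom :: "fm \<Rightarrow> bool" where
  K: "classical_axiom (Imp A (Imp B A))"
| S: "classical_axiom (Imp (Imp A (Imp B C)) (Imp (Imp A B) (Imp A C)))"
| AndE1: "classical_axiom (Imp (And A B) A)"
| AndE2: "classical_axiom (Imp (And A B) B)"
| AndI: "classical_axiom (Imp A (Imp B (And A B)))"
| OrI1: "classical_axiom (Imp A (Or A B))"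
| OrI2: "classical_axiom (Imp B (Or A B))"
| OrE: "classical_axiom (Imp (Imp A C) (Imp (Imp B C) (Imp (Or A B) C)))"
| NegI: "classical_axiom (Imp (Imp A B) (Imp (Imp A (Neg B)) (Neg A)))"
| NegE: "classical_axiom (Imp (Neg (Neg A)) A)"

inductive LP_axiom :: "fm \<Rightarrow> bool" where
  classical: "classical_axiom A \<Longrightarrow> LP_axiom A"
| C: "LP_axiom (Imp (And (Box A) (Box B)) (Box (And A B)))"
| H: "LP_axiom (Imp (Or (Box A) (Box B)) (Box (Or A B)))"
| T: "LP_axiom (Imp (Box A) A)"
| N: "LP_axiom (Box Top)"

inductive LP_theorem :: "fm \<Rightarrow> bool" where
  Ax: "LP_axiom A \<Longrightarrow> LP_theorem A"
| MP: "LP_theorem (Imp A B) \<Longrightarrow> LP_theorem A \<Longrightarrow> LP_theorem B"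
| RE: "LP_theorem (Iff A B) \<Longrightarrow> LP_theorem (Iff (Box A) (Box B))"

definition is_deduction :: "fm set \<Rightarrow> fm list \<Rightarrow> fm \<Rightarrow> bool" where
  "is_deduction \<Gamma> D A \<longleftrightarrow>
     D \<noteq> [] \<and> last D = A \<and>
     (\<forall>i < length D.
        D ! i \<in> \<Gamma>
        \<or> LP_axiom (D ! i)
        \<or> (\<exists>j < i. \<exists>k < i. D ! j = Imp (D ! k) (D ! i))
        \<or> (\<exists>B C. LP_theorem (Iff B C) \<and> D ! i = Iff (Box B) (Box C)))"

definition deducible :: "fm set \<Rightarrow> fm \<Rightarrow> bool"  (infix "\<turnstile>" 50) where
  "\<Gamma> \<turnstile> A \<longleftrightarrow> (\<exists>D. is_deduction \<Gamma> D A)"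

record 'w model =
  worlds :: "'w set"
  nbhd :: "'w \<Rightarrow> 'w set set"
  val :: "nat \<Rightarrow> 'w set"

definition relational_model :: "'w model \<Rightarrow> bool" where
  "relational_model M \<longleftrightarrow>
     worlds M \<noteq> {} \<and>
     (\<forall>i. val M i \<subseteq> worlds M) \<and>
     (\<forall>\<alpha> \<in> worlds M. nbhd M \<alpha> \<subseteq> Pow (worlds M)) \<and>
     (\<forall>\<alpha> \<in> worlds M. \<forall>X \<subseteq> worlds M. \<forall>Y \<subseteq> worlds M.
        (X \<in> nbhd M \<alpha> \<and> Y \<in> nbhd M \<alpha> \<longrightarrow> X \<inter> Y \<in> nbhd M \<alpha>) \<and>
        (X \<in> nbhd M \<alpha> \<or> Y \<in> nbhd M \<alpha> \<longrightarrow> X \<union> Y \<in> nbhd M \<alpha>) \<and>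
        (X \<in> nbhd M \<alpha> \<longrightarrow> \<alpha> \<in> X) \<and>
        worlds M \<in> nbhd M \<alpha>)"

primrec true_at :: "'w model \<Rightarrow> 'w \<Rightarrow> fm \<Rightarrow> bool" where
  "true_at M \<alpha> (Var i) \<longleftrightarrow> \<alpha> \<in> val M i"
| "true_at M \<alpha> (Neg A) \<longleftrightarrow> \<not> true_at M \<alpha> A"
| "true_at M \<alpha> (And A B) \<longleftrightarrow> true_at M \<alpha> A \<and> true_at M \<alpha> B"
| "true_at M \<alpha> (Or A B) \<longleftrightarrow> true_at M \<alpha> A \<or> true_at M \<alpha> B"
| "true_at M \<alpha> (Imp A B) \<longleftrightarrow> (true_at M \<alpha> A \<longrightarrow> true_at M \<alpha> B)"
| "true_at M \<alpha> (Box A) \<longleftrightarrow> {\<beta> \<in> worlds M. true_at M \<beta> A} \<in> nbhd M \<alpha>"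

definition true_in :: "'w model \<Rightarrow> fm \<Rightarrow> bool" where
  "true_in M A \<longleftrightarrow> (\<forall>\<alpha> \<in> worlds M. true_at M \<alpha> A)"

text \<open>HOL cannot quantify over the type of worlds inside a formula, so consequence is
  relative to a type \<open>'w\<close>; a theorem polymorphic in \<open>'w\<close> covers all models.\<close>

definition consequence :: "'w itself \<Rightarrow> fm set \<Rightarrow> fm \<Rightarrow> bool" where
  "consequence (_ :: 'w itself) \<Gamma> A \<longleftrightarrow>
     (\<forall>M :: 'w model. relational_model M \<longrightarrow>
        (\<forall>B \<in> \<Gamma>. true_in M B) \<longrightarrow> true_in M A)"

end

theory Submission
  imports Defs
begin

text \<open>
  Every formula denotes a truth set, and \<open>Box\<close> asks whether that set is a neighbourhood of the
  current world. The connectives \<open>And\<close> and \<open>Or\<close> act on truth sets as intersection and union,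
  \<open>Top\<close> denotes the whole set of worlds, and so each of the conditions (c), (h), (t), (n) on
  neighbourhoods makes one modal axiom valid (\<open>LP_axiom_true\<close>).

  The rule RE is sound because a biconditional true at all worlds forces the two truth sets to
  coincide, and \<open>Box\<close> sees its argument only through that set (\<open>true_in_RE\<close>). Agreement at a
  single world would not suffice, so the induction over theorems (\<open>LP_theorem_true\<close>) carries
  truth in the whole model. In a deduction the premise of RE is a theorem, hence covered by that
  induction; Modus Ponens preserves truth at each world, so in a model of the premises every
  entry of the deduction is true at every world.
\<close>

lemma truth_set_And:
  "{\<beta> \<in> worlds M. true_at M \<beta> (And A B)} =
   {\<beta> \<in> worlds M. true_at M \<beta> A} \<inter> {\<beta> \<in> worlds M. true_at M \<beta> B}"
  by auto

lemma truth_set_Or: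
  "{\<beta> \<in> worlds M. true_at M \<beta> (Or A B)} =
   {\<beta> \<in> worlds M. true_at M \<beta> A} \<union> {\<beta> \<in> worlds M. true_at M \<beta> B}"
  by auto

lemma truth_set_Top: "{\<beta> \<in> worlds M. true_at M \<beta> Top} = worlds M"
  by (auto simp: Top_def)

lemma true_at_classical_axiom: "classical_axiom A \<Longrightarrow> true_at M \<alpha> A"
  by (induction rule: classical_axiom.induct) auto

lemma LP_axiom_true:
  assumes M: "relational_model M" and ax: "LP_axiom A"
  shows "true_in M A"
proof -
  have "true_at M \<alpha> A" if \<alpha>: "\<alpha> \<in> worlds M" for \<alpha>
  proof -
    let ?t = "\<lambda>A. {\<beta> \<in> worlds M. true_at M \<beta> A}"
    have sub: "?t B \<subseteq> worlds M" for B by auto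
    have closure: "(?t B \<in> nbhd M \<alpha> \<and> ?t C \<in> nbhd M \<alpha> \<longrightarrow> ?t B \<inter> ?t C \<in> nbhd M \<alpha>) \<and>
        (?t B \<in> nbhd M \<alpha> \<or> ?t C \<in> nbhd M \<alpha> \<longrightarrow> ?t B \<union> ?t C \<in> nbhd M \<alpha>) \<and>
        (?t B \<in> nbhd M \<alpha> \<longrightarrow> \<alpha> \<in> ?t B) \<and> worlds M \<in> nbhd M \<alpha>" for B C
      using M \<alpha> sub[of B] sub[of C] unfolding relational_model_def by blast
    from ax show ?thesis
    proof cases
      case classical
      then show ?thesis by (rule true_at_classical_axiom)
    next
      case (C B D)
      have "true_at M \<alpha> (Box (And B D))" if "true_at M \<alpha> (And (Box B) (Box D))"
        using that closure[of B D] unfolding true_at.simps(6) truth_set_And by simp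
      then show ?thesis using C by simp
    next
      case (H B D)
      have "true_at M \<alpha> (Box (Or B D))" if "true_at M \<alpha> (Or (Box B) (Box D))"
        using that closure[of B D] unfolding true_at.simps(6) truth_set_Or by simp
      then show ?thesis using H by simp
    next
      case (T B)
      then show ?thesis using closure[of B B] by auto
    next
      case N
      then show ?thesis using closure by (simp add: truth_set_Top)
    qed
  qed
  then show ?thesis by (simp add: true_in_def)
qed

lemma true_in_MP: "true_in M (Imp A B) \<Longrightarrow> true_in M A \<Longrightarrow> true_in M B"
  by (simp add: true_in_def)

text \<open>The premise must hold throughout the model: a biconditional true only at one world
  says nothing about equality of the truth sets.\<close>

lemma true_in_RE:
  assumes "true_in M (Iff A B)"
  shows "true_in M (Iff (Box A) (Box B))"
proof -
  have "{\<beta> \<in> worlds M. true_at M \<beta> A} = {\<beta> \<in> worlds M. true_at M \<beta> B}"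
    using assms by (auto simp: true_in_def Iff_def)
  then show ?thesis by (simp add: true_in_def Iff_def)
qed

lemma LP_theorem_true: "LP_theorem A \<Longrightarrow> relational_model M \<Longrightarrow> true_in M A"
  by (induction rule: LP_theorem.induct) (blast intro: LP_axiom_true true_in_MP true_in_RE)+

text \<open>Modus Ponens refers to arbitrary earlier entries, hence complete induction on the
  position.\<close>

lemma is_deduction_entries_true:
  assumes D: "is_deduction \<Gamma> D A" and M: "relational_model M"
    and \<Gamma>: "\<forall>B \<in> \<Gamma>. true_in M B"
  shows "i < length D \<Longrightarrow> true_in M (D ! i)"
proof (induction i rule: less_induct)
  case (less i)
  with D consider "D ! i \<in> \<Gamma>" | "LP_axiom (D ! i)"
    | j k where "j < i" "k < i" "D ! j = Imp (D ! k) (D ! i)"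
    | B C where "LP_theorem (Iff B C)" "D ! i = Iff (Box B) (Box C)"
    unfolding is_deduction_def by blast
  then show ?case
  proof cases
    case 1
    then show ?thesis using \<Gamma> by blast
  next
    case 2
    then show ?thesis using M by (blast intro: LP_axiom_true)
  next
    case 3
    then have "true_in M (Imp (D ! k) (D ! i))" "true_in M (D ! k)"
      using less.IH[of j] less.IH[of k] less.prems by auto
    then show ?thesis by (rule true_in_MP)
  next
    case 4
    then show ?thesis using M by (simp add: LP_theorem_true true_in_RE)
  qed
qed

theorem mainTheorem2:
  fixes \<Gamma> :: "fm set" and A :: fm
  assumes "\<Gamma> \<turnstile> A"
  shows "consequence TYPE('w) \<Gamma> A"
  unfolding consequence_def
proof (intro allI impI)
  fix M :: "'w model"
  assume M: "relational_model M" and \<Gamma>: "\<forall>B \<in> \<Gamma>. true_in M B"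
  obtain D where D: "is_deduction \<Gamma> D A"
    using assms unfolding deducible_def by blast
  then have "D \<noteq> []" "A = D ! (length D - 1)"
    by (auto simp: is_deduction_def last_conv_nth)
  then show "true_in M A"
    using is_deduction_entries_true[OF D M \<Gamma>, of "length D - 1"] by simp
qed

end
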